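(* If $n\ge 5$ and $q\ge 1$, then the diameter of $A\Gamma_n^q$ equals $2$.
   Context: $X=\{1,\dots,n\}$, $A_n$ the alternating group on $X$, $\mathcal{E}_n=\{\sigma\in A_n: i^\sigma\neq i \text{ for all } i\in X\}$. $A\Gamma_n$ is the Cayley graph $\Gamma(A_n,\mathcal{E}_n)$ (vertex set $A_n$, edges $\{g,sg\}$, $s\in\mathcal{E}_n$). $A\Gamma_n^q$ is the tensor product of $q$ copies of $A\Gamma_n$: vertex set $A_n^q$, with $(\sigma_1,\dots,\sigma_q)$ adjacent to $(\tau_1,\dots,\tau_q)$ iff $\sigma_k$ is adjacent to $\tau_k$ in $A\Gamma_n$ for every $k$. *)

theory Defs
  imports
    "HOL-Algebra.Sym_Groups"
    "HOL-Library.FuncSet"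
    "Graph_Theory.Pair_Digraph"
    "Graph_Theory.Shortest_Path"
begin

text \<open>
  As in the session \<open>Graph_Theory\<close>, an undirected graph is a symmetric digraph; an edge
  \<open>{u, v}\<close> is the pair of arcs \<open>(u, v)\<close> and \<open>(v, u)\<close>.
\<close>

definition cayley_graph :: "('a, 'b) monoid_scheme \<Rightarrow> 'a set \<Rightarrow> 'a pair_pre_digraph" where
  "cayley_graph G S =
     \<lparr> pverts = carrier G,
       parcs = {(g, h). g \<in> carrier G \<and> h \<in> carrier G \<and>
                  (\<exists>s\<in>S. h = s \<otimes>\<^bsub>G\<^esub> g \<or> g = s \<otimes>\<^bsub>G\<^esub> h)} \<rparr>"

definition tensor_power :: "'a pair_pre_digraph \<Rightarrow> nat \<Rightarrow> (nat \<Rightarrow> 'a) pair_pre_digraph" where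
  "tensor_power G q =
     \<lparr> pverts = {1..q} \<rightarrow>\<^sub>E pverts G,
       parcs = {(x, y). x \<in> {1..q} \<rightarrow>\<^sub>E pverts G \<and> y \<in> {1..q} \<rightarrow>\<^sub>E pverts G \<and>
                  (\<forall>k\<in>{1..q}. (x k, y k) \<in> parcs G)} \<rparr>"

definition even_derangements :: "nat \<Rightarrow> (nat \<Rightarrow> nat) set" where
  "even_derangements n = {\<sigma> \<in> carrier (alt_group n). \<forall>i\<in>{1..n}. \<sigma> i \<noteq> i}"

definition alt_derangement_graph :: "nat \<Rightarrow> (nat \<Rightarrow> nat) pair_pre_digraph" where
  "alt_derangement_graph n = cayley_graph (alt_group n) (even_derangements n)"

text \<open>
  With unit weights, \<open>\<mu>\<close> is the infimum of the lengths of all walks between two vertices,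
  i.e. the graph distance, with value \<open>\<infinity>\<close> if there is no walk.
\<close>

definition (in wf_digraph) graph_distance :: "'a \<Rightarrow> 'a \<Rightarrow> ereal" where
  "graph_distance u v = \<mu> (\<lambda>_. 1) u v"

definition (in wf_digraph) graph_diameter :: ereal where
  "graph_diameter = (SUP (u, v) \<in> verts G \<times> verts G. graph_distance u v)"

lemma (in wf_digraph) graph_distance_eq:
  "graph_distance u v = (INF p \<in> {p. awalk u p v}. ereal (real (length p)))"
  by (simp add: graph_distance_def \<mu>_def awalk_cost_def sum_list_triv)

lemma even_derangements_conj:
  assumes g: "g \<in> carrier (alt_group n)" and s: "s \<in> even_derangements n"
  shows "inv' g \<circ> s \<circ> g \<in> even_derangements n" "g \<circ> s \<circ> inv' g \<in> even_derangements n"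
proof -
  have conj: "inv' p \<circ> s \<circ> p \<in> even_derangements n" if p: "p \<in> carrier (alt_group n)" for p
  proof -
    interpret A: group "alt_group n" by (rule alt_group_is_group)
    have "inv' p \<otimes>\<^bsub>alt_group n\<^esub> s \<otimes>\<^bsub>alt_group n\<^esub> p \<in> carrier (alt_group n)"
      using p s alt_group_inv_closed[OF p] by (auto simp: even_derangements_def)
    then have c: "inv' p \<circ> s \<circ> p \<in> carrier (alt_group n)"
      by (simp add: alt_group_mult)
    have pp: "p permutes {1..n}" using p by (simp add: alt_group_carrier)
    have "(inv' p \<circ> s \<circ> p) i \<noteq> i" if i: "i \<in> {1..n}" for i
    proof
      assume "(inv' p \<circ> s \<circ> p) i = i"
      then have "s (p i) = p i"
        using permutes_inverses(1)[OF pp, of "s (p i)"] by simp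
      moreover have "p i \<in> {1..n}" using permutes_in_image[OF pp] i by blast
      ultimately show False using s by (auto simp: even_derangements_def)
    qed
    with c show ?thesis by (simp add: even_derangements_def)
  qed
  show "inv' g \<circ> s \<circ> g \<in> even_derangements n" by (rule conj[OF g])
  have "permutation g" by (rule alt_group_carrier'[OF g])
  then have "inv' (inv' g) = g" by (simp add: inv_inv_eq permutation_bijective)
  with conj[OF alt_group_inv_closed[OF g]] show "g \<circ> s \<circ> inv' g \<in> even_derangements n" by simp
qed

text \<open>
  The product of \<open>alt_group\<close> is \<open>(\<circ>)\<close>, whereas for permutations acting on the right \<open>s g\<close>
  means \<open>g \<circ> s\<close>. Both conventions give the same graph.
\<close>

lemma alt_derangement_mult_order:
  assumes g: "g \<in> carrier (alt_group n)"
  shows "(\<exists>s\<in>even_derangements n. h = s \<circ> g) \<longleftrightarrow> (\<exists>s\<in>even_derangements n. h = g \<circ> s)"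
proof -
  have gp: "g permutes {1..n}" using g by (simp add: alt_group_carrier)
  show ?thesis
  proof
    assume "\<exists>s\<in>even_derangements n. h = s \<circ> g"
    then obtain s where s: "s \<in> even_derangements n" "h = s \<circ> g" by blast
    have "h = g \<circ> (inv' g \<circ> s \<circ> g)"
      using s(2) permutes_inverses(1)[OF gp] by (simp add: fun_eq_iff)
    then show "\<exists>s\<in>even_derangements n. h = g \<circ> s"
      using even_derangements_conj(1)[OF g s(1)] by blast
  next
    assume "\<exists>s\<in>even_derangements n. h = g \<circ> s"
    then obtain s where s: "s \<in> even_derangements n" "h = g \<circ> s" by blast
    have "h = (g \<circ> s \<circ> inv' g) \<circ> g"
      using s(2) permutes_inverses(2)[OF gp] by (simp add: fun_eq_iff)
    then show "\<exists>s\<in>even_derangements n. h = s \<circ> g"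
      using even_derangements_conj(2)[OF g s(1)] by blast
  qed
qed

lemma pair_graph_alt_derangement_graph:
  assumes "n \<ge> 1"
  shows "pair_graph (alt_derangement_graph n)"
proof
  have "finite {p :: nat \<Rightarrow> nat. p permutes {1..n}}" by (simp add: finite_permutations)
  then have fin: "finite (carrier (alt_group n))"
    by (rule rev_finite_subset) (auto simp: alt_group_carrier)
  then show "finite (pverts (alt_derangement_graph n))"
    by (simp add: alt_derangement_graph_def cayley_graph_def)
  show "finite (parcs (alt_derangement_graph n))"
    by (rule finite_subset[OF _ finite_cartesian_product[OF fin fin]])
       (auto simp: alt_derangement_graph_def cayley_graph_def)
  show "symmetric (with_proj (alt_derangement_graph n))"
    by (auto simp: symmetric_def sym_def alt_derangement_graph_def cayley_graph_def
        arcs_ends_conv image_iff)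
  fix e assume e: "e \<in> parcs (alt_derangement_graph n)"
  then show "fst e \<in> pverts (alt_derangement_graph n)"
    and "snd e \<in> pverts (alt_derangement_graph n)"
    by (auto simp: alt_derangement_graph_def cayley_graph_def)
  show "fst e \<noteq> snd e"
  proof
    assume eq: "fst e = snd e"
    with e obtain g s where g: "g permutes {1..n}" and s: "s \<in> even_derangements n"
      and gs: "g = s \<circ> g"
      by (auto simp: alt_derangement_graph_def cayley_graph_def alt_group_carrier alt_group_mult)
    have "s 1 = s (g (inv' g 1))" using permutes_inverses(1)[OF g] by simp
    also have "\<dots> = g (inv' g 1)" using gs by (metis comp_apply)
    also have "\<dots> = 1" using permutes_inverses(1)[OF g] by simp
    finally show False using s assms by (auto simp: even_derangements_def)
  qed
qed

lemma pair_graph_tensor_power: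
  assumes "pair_graph G" "q \<ge> 1"
  shows "pair_graph (tensor_power G q)"
proof -
  interpret G: pair_graph G by fact
  have fin: "finite ({1..q} \<rightarrow>\<^sub>E pverts G)" by (simp add: finite_PiE)
  show ?thesis
  proof
    show "finite (pverts (tensor_power G q))" using fin by (simp add: tensor_power_def)
    show "finite (parcs (tensor_power G q))"
      by (rule finite_subset[OF _ finite_cartesian_product[OF fin fin]])
         (auto simp: tensor_power_def)
    show "symmetric (with_proj (tensor_power G q))"
      using G.sym_arcs
      by (auto simp: symmetric_def sym_def tensor_power_def arcs_ends_conv image_iff)
    fix e assume e: "e \<in> parcs (tensor_power G q)"
    then show "fst e \<in> pverts (tensor_power G q)" and "snd e \<in> pverts (tensor_power G q)"
      by (auto simp: tensor_power_def)
    have "(fst e 1, snd e 1) \<in> parcs G" using e assms(2) by (auto simp: tensor_power_def)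
    then show "fst e \<noteq> snd e" using G.pair_no_loops by force
  qed
qed

end

theory Submission
  imports Defs
begin

text \<open>
  Two vertices \<open>x\<close> and \<open>y\<close> of the derangement graph have a common neighbour \<open>\<tau> \<circ> x\<close> as soon as
  there is an even permutation \<open>\<tau>\<close> with \<open>\<tau> i \<notin> {i, \<sigma> i}\<close> for all \<open>i\<close>, where
  \<open>\<sigma> = y \<circ> x\<inverse>\<close>. Such a \<open>\<tau>\<close> exists for every permutation \<open>\<sigma>\<close> of at least five points: on five
  points \<open>\<tau>\<close> can be chosen as a 5-cycle, and a new point is inserted by composing with a 3-cycle,
  which preserves the parity. Choosing common neighbours in every coordinate bounds the diameter
  of the tensor power by 2; the constant tuples at the identity and at a 3-cycle, which has a
  fixed point, attain the bound.
\<close>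

section \<open>Even permutations avoiding the identity and a given permutation\<close>

text \<open>Finite case check over the 5-cycles \<open>(a p q r s)\<close>. Injectivity matters: a
  constant map with value \<open>b\<close> agrees somewhere with every 5-cycle.\<close>

lemma ex_5_cycle_avoiding:
  fixes a b c d e :: 'a and f :: "'a \<Rightarrow> 'a"
  assumes "distinct [a, b, c, d, e]" and "inj f"
  shows "\<exists>p q r s. distinct [a, p, q, r, s] \<and> {p, q, r, s} = {b, c, d, e} \<and>
    f a \<noteq> p \<and> f p \<noteq> q \<and> f q \<noteq> r \<and> f r \<noteq> s \<and> f s \<noteq> a"
proof (rule ccontr)
  assume "\<not> ?thesis"
  then have *: "f a = p \<or> f p = q \<or> f q = r \<or> f r = s \<or> f s = a"
    if "distinct [a, p, q, r, s]" "{p, q, r, s} = {b, c, d, e}" for p q r s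
    using that by blast
  have ne: "f a \<noteq> f b" "f a \<noteq> f c" "f a \<noteq> f d" "f a \<noteq> f e" "f b \<noteq> f c" "f b \<noteq> f d" "f b \<noteq> f e"
    "f c \<noteq> f d" "f c \<noteq> f e" "f d \<noteq> f e"
    using assms by (auto dest: injD)
  \<comment> \<open>One disjunction for each of the 24 orders of \<open>b, c, d, e\<close> after
    \<open>a\<close>, hence one for each 5-cycle. Each says that \<open>f\<close> agrees with that
    cycle somewhere. Together with the distinctness of the values in \<open>ne\<close> they are
    contradictory.\<close>
  have
    "f a = b \<or> f b = c \<or> f c = d \<or> f d = e \<or> f e = a"
    "f a = b \<or> f b = c \<or> f c = e \<or> f e = d \<or> f d = a"
    "f a = b \<or> f b = d \<or> f d = c \<or> f c = e \<or> f e = a"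
    "f a = b \<or> f b = d \<or> f d = e \<or> f e = c \<or> f c = a"
    "f a = b \<or> f b = e \<or> f e = c \<or> f c = d \<or> f d = a"
    "f a = b \<or> f b = e \<or> f e = d \<or> f d = c \<or> f c = a"
    "f a = c \<or> f c = b \<or> f b = d \<or> f d = e \<or> f e = a"
    "f a = c \<or> f c = b \<or> f b = e \<or> f e = d \<or> f d = a"
    "f a = c \<or> f c = d \<or> f d = b \<or> f b = e \<or> f e = a"
    "f a = c \<or> f c = d \<or> f d = e \<or> f e = b \<or> f b = a"
    "f a = c \<or> f c = e \<or> f e = b \<or> f b = d \<or> f d = a"
    "f a = c \<or> f c = e \<or> f e = d \<or> f d = b \<or> f b = a"
    "f a = d \<or> f d = b \<or> f b = c \<or> f c = e \<or> f e = a"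
    "f a = d \<or> f d = b \<or> f b = e \<or> f e = c \<or> f c = a"
    "f a = d \<or> f d = c \<or> f c = b \<or> f b = e \<or> f e = a"
    "f a = d \<or> f d = c \<or> f c = e \<or> f e = b \<or> f b = a"
    "f a = d \<or> f d = e \<or> f e = b \<or> f b = c \<or> f c = a"
    "f a = d \<or> f d = e \<or> f e = c \<or> f c = b \<or> f b = a"
    "f a = e \<or> f e = b \<or> f b = c \<or> f c = d \<or> f d = a"
    "f a = e \<or> f e = b \<or> f b = d \<or> f d = c \<or> f c = a"
    "f a = e \<or> f e = c \<or> f c = b \<or> f b = d \<or> f d = a"
    "f a = e \<or> f e = c \<or> f c = d \<or> f d = b \<or> f b = a"
    "f a = e \<or> f e = d \<or> f d = b \<or> f b = c \<or> f c = a"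
    "f a = e \<or> f e = d \<or> f d = c \<or> f c = b \<or> f b = a"
    by (rule *; use assms(1) in auto)+
  with ne assms(1) show False
    by (smt (verit) distinct_length_2_or_more)
qed

lemma even_permutation_avoiding_5:
  assumes "card S = 5" and "f permutes S"
  shows "\<exists>\<tau>. \<tau> permutes S \<and> evenperm \<tau> \<and> (\<forall>i\<in>S. \<tau> i \<noteq> i \<and> \<tau> i \<noteq> f i)"
proof -
  obtain xs where xs: "set xs = S" "distinct xs" "length xs = 5"
    using assms(1) by (metis card.infinite distinct_card finite_distinct_list zero_neq_numeral)
  then obtain a b c d e where "xs = [a, b, c, d, e]"
    by (auto simp: eval_nat_numeral length_Suc_conv)
  with xs have S: "S = {a, b, c, d, e}" and dist: "distinct [a, b, c, d, e]" by auto
  from ex_5_cycle_avoiding[OF dist permutes_inj[OF assms(2)]]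
  obtain p q r s where c: "distinct [a, p, q, r, s]" "{p, q, r, s} = {b, c, d, e}"
    and av: "f a \<noteq> p" "f p \<noteq> q" "f q \<noteq> r" "f r \<noteq> s" "f s \<noteq> a" by blast
  have S': "S = {a, p, q, r, s}" using S c(2) by auto
  \<comment> \<open>The 5-cycle \<open>a\<close>, \<open>p\<close>, \<open>q\<close>,
    \<open>r\<close>, \<open>s\<close> as a product of four transpositions, which makes it
    even.\<close>
  define \<tau> where "\<tau> = transpose a p \<circ> (transpose p q \<circ> (transpose q r \<circ> transpose r s))"
  have \<tau>: "\<tau> a = p" "\<tau> p = q" "\<tau> q = r" "\<tau> r = s" "\<tau> s = a"
    using c(1) by (auto simp: \<tau>_def transpose_def)
  have "\<tau> permutes S"
    unfolding \<tau>_def S' by (intro permutes_compose permutes_swap_id) auto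
  moreover have "evenperm \<tau>"
    using c(1) by (simp add: \<tau>_def evenperm_comp evenperm_swap permutation_swap_id permutation_compose)
  moreover have "\<forall>i\<in>S. \<tau> i \<noteq> i \<and> \<tau> i \<noteq> f i"
    using c(1) av by (auto simp: S' \<tau>)
  ultimately show ?thesis by blast
qed

text \<open>Cut \<open>x\<close> out of \<open>f\<close> to get a permutation \<open>g\<close> of
  \<open>T\<close>, and take \<open>\<rho>\<close> avoiding \<open>g\<close>. Multiplying
  \<open>\<rho>\<close> by a 3-cycle through \<open>x\<close> and two points \<open>i\<close>,
  \<open>k\<close> of \<open>T\<close> keeps it even. Only the images of \<open>x\<close>,
  \<open>i\<close>, \<open>k\<close> change, so finitely many bad choices of \<open>i\<close> and
  \<open>k\<close> have to be excluded.\<close>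

lemma even_permutation_avoiding_insert:
  assumes T: "finite T" "x \<notin> T" "card T \<ge> 5"
    and IH: "\<And>f. f permutes T \<Longrightarrow>
      \<exists>\<tau>. \<tau> permutes T \<and> evenperm \<tau> \<and> (\<forall>i\<in>T. \<tau> i \<noteq> i \<and> \<tau> i \<noteq> f i)"
    and f: "f permutes insert x T"
  shows "\<exists>\<tau>. \<tau> permutes insert x T \<and> evenperm \<tau> \<and> (\<forall>i\<in>insert x T. \<tau> i \<noteq> i \<and> \<tau> i \<noteq> f i)"
proof -
  define g where "g = transpose x (f x) \<circ> f"
  have "g permutes T" unfolding g_def by (rule permutes_insert_lemma[OF f])
  then obtain \<rho> where \<rho>: "\<rho> permutes T" "evenperm \<rho>"
    and av: "\<And>i. i \<in> T \<Longrightarrow> \<rho> i \<noteq> i \<and> \<rho> i \<noteq> g i"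
    using IH by metis
  have f_inj: "f i = f j \<longleftrightarrow> i = j" for i j
    using permutes_inj[OF f] by (auto dest: injD)
  have \<rho>_inj: "\<rho> i = \<rho> j \<longleftrightarrow> i = j" for i j
    using permutes_inj[OF \<rho>(1)] by (auto dest: injD)
  have \<rho>x: "\<rho> x = x" using \<rho>(1) T(2) by (simp add: permutes_not_in)
  have \<rho>T: "\<rho> i \<in> T" if "i \<in> T" for i using permutes_in_image[OF \<rho>(1)] that by simp
  \<comment> \<open>On \<open>T\<close>, \<open>g\<close> differs from \<open>f\<close> only at the
    preimage of \<open>x\<close>; there \<open>\<rho>\<close> avoids \<open>f\<close> because its
    value lies in \<open>T\<close>.\<close>
  have av': "\<rho> i \<noteq> f i" if i: "i \<in> T" for i
  proof (cases "f i = x")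
    case True
    then show ?thesis using \<rho>T[OF i] T(2) by auto
  next
    case False
    moreover have "f i \<noteq> f x" using f_inj i T(2) by auto
    ultimately have "g i = f i" by (simp add: g_def)
    then show ?thesis using av[OF i] by simp
  qed
  \<comment> \<open>The value \<open>\<rho> i\<close> will become the image of \<open>x\<close>, so
    it must differ from \<open>f x\<close>.\<close>
  have "card (T - {inv' \<rho> (f x)}) > 0"
    using T by (simp add: card_Diff_singleton_if)
  then obtain i where i: "i \<in> T" "i \<noteq> inv' \<rho> (f x)" by (auto simp: card_gt_0_iff)
  have ri: "\<rho> i \<noteq> f x" using i(2) permutes_inverses(2)[OF \<rho>(1)] by metis
  \<comment> \<open>The four bad values for \<open>k\<close>: the first keeps the 3-cycle
    nondegenerate, the second guards the new value \<open>x\<close> at \<open>k\<close>, and the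
    last two guard the new value \<open>\<rho> k\<close> at \<open>i\<close>. Five points in
    \<open>T\<close> leave a choice.\<close>
  let ?X = "{i, inv' f x, inv' \<rho> i, inv' \<rho> (f i)}"
  have "card ?X \<le> 4" by (simp add: card_insert_if)
  then have "\<not> T \<subseteq> ?X" using T(3) card_mono[of ?X T] by fastforce
  then obtain k where k: "k \<in> T" "k \<noteq> i" "k \<noteq> inv' f x" "k \<noteq> inv' \<rho> i" "k \<noteq> inv' \<rho> (f i)"
    by blast
  have fk: "f k \<noteq> x" using k(3) permutes_inverses(2)[OF f] by metis
  have rk: "\<rho> k \<noteq> i" "\<rho> k \<noteq> f i"
    using k(4,5) permutes_inverses(2)[OF \<rho>(1)] by metis+
  have xik: "x \<noteq> i" "x \<noteq> k" using i k T(2) by auto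
  \<comment> \<open>The inner factor is the 3-cycle sending \<open>x\<close> to \<open>i\<close>,
    \<open>i\<close> to \<open>k\<close> and \<open>k\<close> to \<open>x\<close>.\<close>
  define \<tau> where "\<tau> = \<rho> \<circ> (transpose i k \<circ> transpose x k)"
  have \<tau>: "\<tau> x = \<rho> i" "\<tau> i = \<rho> k" "\<tau> k = x" "\<And>j. j \<notin> {x, i, k} \<Longrightarrow> \<tau> j = \<rho> j"
    using xik k(2) \<rho>x by (auto simp: \<tau>_def transpose_def)
  have "\<tau> permutes insert x T"
    unfolding \<tau>_def using i(1) k(1)
    by (intro permutes_compose permutes_swap_id permutes_subset[OF \<rho>(1)]) auto
  moreover have "permutation \<rho>" using \<rho>(1) T(1) by (auto simp: permutation_permutes)
  then have "evenperm \<tau>"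
    using \<rho>(2) xik k(2)
    by (simp add: \<tau>_def evenperm_comp evenperm_swap permutation_swap_id permutation_compose)
  moreover have "\<tau> j \<noteq> j \<and> \<tau> j \<noteq> f j" if j: "j \<in> insert x T" for j
  proof (cases "j \<in> {x, i, k}")
    case True
    then show ?thesis using \<tau>(1-3) ri rk fk xik \<rho>T[OF i(1)] T(2) by auto
  next
    case False
    then show ?thesis using \<tau>(4) j av av' by auto
  qed
  ultimately show ?thesis by blast
qed

text \<open>The bound 5 is sharp: on four points the even derangements are the three double
  transpositions, and a 3-cycle agrees somewhere with each of them.\<close>

lemma even_permutation_avoiding:
  assumes "finite S" and "card S \<ge> 5" and "f permutes S"
  shows "\<exists>\<tau>. \<tau> permutes S \<and> evenperm \<tau> \<and> (\<forall>i\<in>S. \<tau> i \<noteq> i \<and> \<tau> i \<noteq> f i)"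
  using assms
proof (induction S arbitrary: f rule: finite_induct)
  case empty
  then show ?case by simp
next
  case (insert x T)
  show ?case
  proof (cases "card T \<ge> 5")
    case True
    then show ?thesis
      using insert by (intro even_permutation_avoiding_insert) auto
  next
    \<comment> \<open>The induction starts here: the inserted point is the fifth.\<close>
    case False
    then have "card (insert x T) = 5" using insert by simp
    then show ?thesis using insert.prems(2) by (rule even_permutation_avoiding_5)
  qed
qed

section \<open>Adjacency in the derangement graph\<close>

lemma alt_derangement_graph_verts:
  "pverts (alt_derangement_graph n) = carrier (alt_group n)"
  by (simp add: alt_derangement_graph_def cayley_graph_def)

lemma alt_derangement_graph_arcs:
  "(g, h) \<in> parcs (alt_derangement_graph n) \<longleftrightarrow>
    g \<in> carrier (alt_group n) \<and> h \<in> carrier (alt_group n) \<and>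
    (\<exists>s\<in>even_derangements n. h = s \<circ> g \<or> g = s \<circ> h)"
  by (simp add: alt_derangement_graph_def cayley_graph_def alt_group_mult)

lemma alt_group_comp_closed:
  assumes "g \<in> carrier (alt_group n)" and "h \<in> carrier (alt_group n)"
  shows "g \<circ> h \<in> carrier (alt_group n)"
  using monoid.m_closed[OF group.is_monoid[OF alt_group_is_group] assms]
  by (simp add: alt_group_mult)

text \<open>The cases \<open>x = y\<close> and \<open>x\<close> adjacent to \<open>y\<close> are
  included on purpose: a walk in a tensor power moves in all coordinates at once, so every pair
  needs a walk of length exactly 2.\<close>

lemma alt_derangement_graph_common_neighbour:
  assumes n: "n \<ge> 5"
    and x: "x \<in> carrier (alt_group n)" and y: "y \<in> carrier (alt_group n)"
  shows "\<exists>z. (x, z) \<in> parcs (alt_derangement_graph n) \<and> (z, y) \<in> parcs (alt_derangement_graph n)"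
proof -
  define f where "f = y \<circ> inv' x"
  have f: "f \<in> carrier (alt_group n)"
    unfolding f_def by (intro alt_group_comp_closed y alt_group_inv_closed[OF x])
  have "f permutes {1..n}" using f by (simp add: alt_group_carrier)
  then obtain \<tau> where \<tau>p: "\<tau> permutes {1..n}" and "evenperm \<tau>"
    and av: "\<And>i. i \<in> {1..n} \<Longrightarrow> \<tau> i \<noteq> i \<and> \<tau> i \<noteq> f i"
    using even_permutation_avoiding[of "{1..n}" f] n by auto
  then have \<tau>: "\<tau> \<in> carrier (alt_group n)" by (simp add: alt_group_carrier)
  with av have \<tau>d: "\<tau> \<in> even_derangements n" by (auto simp: even_derangements_def)
  \<comment> \<open>This factors \<open>f\<close> as \<open>s \<circ> \<tau>\<close>. Since
    \<open>s\<close> sends \<open>\<tau> j\<close> to \<open>f j\<close>, it is a derangement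
    exactly because \<open>\<tau>\<close> avoids \<open>f\<close>.\<close>
  define s where "s = f \<circ> inv' \<tau>"
  have "s \<in> carrier (alt_group n)"
    unfolding s_def by (intro alt_group_comp_closed f alt_group_inv_closed[OF \<tau>])
  moreover have "s i \<noteq> i" if i: "i \<in> {1..n}" for i
  proof -
    have "inv' \<tau> i \<in> {1..n}" using permutes_in_image[OF permutes_inv[OF \<tau>p]] i by blast
    from av[OF this] show ?thesis
      using permutes_inverses(1)[OF \<tau>p] by (simp add: s_def)
  qed
  ultimately have sd: "s \<in> even_derangements n" by (auto simp: even_derangements_def)
  have xp: "x permutes {1..n}" using x by (simp add: alt_group_carrier)
  have "y = s \<circ> (\<tau> \<circ> x)"
    using permutes_inverses(2)[OF \<tau>p] permutes_inverses(2)[OF xp]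
    by (simp add: s_def f_def fun_eq_iff)
  then show ?thesis
    using sd \<tau>d x y alt_group_comp_closed[OF \<tau> x]
    by (auto simp: alt_derangement_graph_arcs)
qed

lemma alt_derangement_graph_nonadjacent:
  assumes "n \<ge> 4"
  shows "\<exists>x y. x \<in> carrier (alt_group n) \<and> y \<in> carrier (alt_group n) \<and> x \<noteq> y \<and>
    (x, y) \<notin> parcs (alt_derangement_graph n)"
proof (intro exI conjI)
  \<comment> \<open>A 3-cycle on 1, 2, 3. It fixes 4, so an arc between it and \<open>id\<close> in
    either direction would give an \<open>s\<close> fixing 4.\<close>
  let ?c = "transpose 1 2 \<circ> transpose 2 (3::nat)"
  show "id \<in> carrier (alt_group n)" by (simp add: alt_group_carrier permutes_id)
  have "?c permutes {1..n}"
    using assms by (intro permutes_compose permutes_swap_id) auto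
  then show "?c \<in> carrier (alt_group n)"
    by (simp add: alt_group_carrier evenperm_comp evenperm_swap permutation_swap_id)
  have "?c 3 = 1" by (simp add: transpose_def)
  then show "id \<noteq> ?c" by (metis id_apply numeral_eq_one_iff semiring_norm(86))
  have c4: "?c 4 = 4" by (simp add: transpose_def)
  have s4: "s 4 \<noteq> 4" if "s \<in> even_derangements n" for s
    using that assms by (auto simp: even_derangements_def)
  show "(id, ?c) \<notin> parcs (alt_derangement_graph n)"
  proof
    assume "(id, ?c) \<in> parcs (alt_derangement_graph n)"
    then obtain s where "s \<in> even_derangements n" "?c = s \<circ> id \<or> id = s \<circ> ?c"
      by (auto simp: alt_derangement_graph_arcs)
    then show False using c4 s4 by (metis comp_apply id_apply)
  qed
qed

section \<open>Distance bounds and the diameter\<close>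

context wf_digraph
begin

lemma graph_distance_le_2:
  assumes "e \<in> arcs G" "tail G e = u" "head G e = w"
    and "e' \<in> arcs G" "tail G e' = w" "head G e' = v"
  shows "graph_distance u v \<le> 2"
proof -
  have "awalk u [e, e'] v" using assms by (auto simp: awalk_simps)
  then have "graph_distance u v \<le> ereal (real (length [e, e']))"
    unfolding graph_distance_eq by (intro INF_lower) simp
  then show ?thesis by simp
qed

text \<open>The assumptions exclude walks of length 0 and 1. If there is no walk at all, the infimum
  is infinite and the bound still holds.\<close>

lemma graph_distance_ge_2:
  assumes "u \<noteq> v" and "\<And>e. e \<in> arcs G \<Longrightarrow> tail G e = u \<Longrightarrow> head G e \<noteq> v"
  shows "graph_distance u v \<ge> 2"
  unfolding graph_distance_eq
proof (rule INF_greatest)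
  fix p assume "p \<in> {p. awalk u p v}"
  then have p: "awalk u p v" by simp
  have "length p \<ge> 2"
  proof (rule ccontr)
    assume "\<not> length p \<ge> 2"
    then consider "p = []" | e where "p = [e]"
      by (cases p; cases "tl p") auto
    then show False
      using p assms by cases (auto simp: awalk_simps)
  qed
  then show "2 \<le> ereal (real (length p))" by simp
qed

end

theorem theorem2p6:
  fixes n q :: nat
  assumes "n \<ge> 5" and "q \<ge> 1"
  shows "wf_digraph.graph_diameter (with_proj (tensor_power (alt_derangement_graph n) q)) = 2"
proof -
  let ?A = "alt_derangement_graph n"
  let ?T = "tensor_power ?A q"
  interpret pair_graph ?T
    using assms by (intro pair_graph_tensor_power pair_graph_alt_derangement_graph) auto
  have verts: "pverts ?T = {1..q} \<rightarrow>\<^sub>E carrier (alt_group n)"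
    by (simp add: tensor_power_def alt_derangement_graph_verts)
  have arcs: "(u, v) \<in> parcs ?T \<longleftrightarrow> u \<in> pverts ?T \<and> v \<in> pverts ?T \<and>
      (\<forall>k\<in>{1..q}. (u k, v k) \<in> parcs ?A)" for u v
    by (simp add: tensor_power_def)
  show ?thesis
  proof (rule antisym)
    have "graph_distance u v \<le> 2" if u: "u \<in> pverts ?T" and v: "v \<in> pverts ?T" for u v
    proof -
      have "\<exists>z. (u k, z) \<in> parcs ?A \<and> (z, v k) \<in> parcs ?A" if "k \<in> {1..q}" for k
        using alt_derangement_graph_common_neighbour[OF assms(1)] u v that
        by (auto simp: verts PiE_iff)
      then obtain z where z: "\<And>k. k \<in> {1..q} \<Longrightarrow> (u k, z k) \<in> parcs ?A \<and> (z k, v k) \<in> parcs ?A"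
        by metis
      \<comment> \<open>Vertices of the power are extensional on \<open>{1..q}\<close>, hence the
        restriction.\<close>
      define w where "w = restrict z {1..q}"
      have "w \<in> pverts ?T"
        using z by (auto simp: verts w_def alt_derangement_graph_arcs)
      then have "(u, w) \<in> parcs ?T" "(w, v) \<in> parcs ?T"
        using z u v by (auto simp: arcs w_def)
      then show ?thesis
        by (intro graph_distance_le_2[of "(u, w)" _ w "(w, v)"]) auto
    qed
    then show "graph_diameter \<le> 2"
      unfolding graph_diameter_def by (intro SUP_least) auto
  next
    obtain x y where xy: "x \<in> carrier (alt_group n)" "y \<in> carrier (alt_group n)" "x \<noteq> y"
      "(x, y) \<notin> parcs ?A"
      using alt_derangement_graph_nonadjacent[of n] assms(1) by auto
    define u v where "u = restrict (\<lambda>_. x) {1..q}" and "v = restrict (\<lambda>_. y) {1..q}"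
    have uv: "u \<in> pverts ?T" "v \<in> pverts ?T" using xy by (auto simp: verts u_def v_def)
    \<comment> \<open>Coordinate 1 exists since \<open>q \<ge> 1\<close>; being distinct and
      nonadjacent there suffices for the tuples.\<close>
    have at1: "u 1 = x" "v 1 = y" using assms(2) by (auto simp: u_def v_def)
    have "u \<noteq> v" using at1 xy(3) by auto
    moreover have "(u, v) \<notin> parcs ?T" using at1 xy(4) assms(2) by (auto simp: arcs)
    ultimately have "2 \<le> graph_distance u v" by (intro graph_distance_ge_2) auto
    also have "\<dots> \<le> graph_diameter"
      unfolding graph_diameter_def using uv by (intro SUP_upper2[of "(u, v)"]) auto
    finally show "2 \<le> graph_diameter" .
  qed
qed

end
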